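(* Let $\{\alpha_n(x)\}_{n\ge1}$ be Dirichlet convolution polynomials and fix $w\in\mathbb{C}$. Then the functions $$\beta_n(x):=\frac{x}{x+w\ln(n)}\,\alpha_n(x+w\ln(n)),\qquad n\ge1,$$ (understood as $\beta_1(x)=\alpha_1(x)$ and, for $n\ge2$, as the polynomial $\beta_n(x)=x\,\hat\alpha_n(x+w\ln n)$) are also Dirichlet convolution polynomials, i.e. $\beta_n(x+y)=\sum_{d\mid n}\beta_d(x)\beta_{n/d}(y)$ for all $n\ge1$ and all $x,y$.
   Context: Polynomials $\{\alpha_n(x)\}_{n\ge1}$ (complex coefficients) are called Dirichlet convolution polynomials if $\alpha_1\equiv 1$ and $$\alpha_n(x+y)=\sum_{d\mid n}\alpha_d(x)\alpha_{n/d}(y)\qquad\text{for all } n\ge1,\ x,y\in\mathbb{R}.$$ For such a family $\alpha_n(0)=0$ for $n\ge2$, and $\hat\alpha_n(x):=x^{-1}\alpha_n(x)$ ($n\ge2$) is a polynomial. $\ln$ is the natural logarithm. *)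

theory Defs
  imports Complex_Main "HOL-Computational_Algebra.Polynomial"
begin

text \<open>The families are indexed by \<open>n \<ge> 1\<close>; the value at index \<open>0\<close> is unconstrained and unused.\<close>

definition dirichlet_convolution_polys :: "(nat \<Rightarrow> complex poly) \<Rightarrow> bool" where
  "dirichlet_convolution_polys \<alpha> \<longleftrightarrow>
     \<alpha> 1 = 1 \<and>
     (\<forall>n\<ge>1. \<forall>x y :: real.
        poly (\<alpha> n) (complex_of_real (x + y)) =
          (\<Sum>d | d dvd n. poly (\<alpha> d) (complex_of_real x) * poly (\<alpha> (n div d)) (complex_of_real y)))"

text \<open>Polynomial division by \<open>x\<close>; it is exact for \<open>n \<ge> 2\<close>, see \<open>hat_poly_exact\<close>.\<close>

definition hat_poly :: "(nat \<Rightarrow> complex poly) \<Rightarrow> nat \<Rightarrow> complex poly" where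
  "hat_poly \<alpha> n = \<alpha> n div [:0, 1:]"

text \<open>For \<open>n \<noteq> 1\<close> this is the polynomial \<open>x * hat_poly \<alpha> n (x + w * ln n)\<close>.\<close>

definition shifted_polys :: "(nat \<Rightarrow> complex poly) \<Rightarrow> complex \<Rightarrow> nat \<Rightarrow> complex poly" where
  "shifted_polys \<alpha> w n =
     (if n = 1 then \<alpha> 1
      else [:0, 1:] * pcompose (hat_poly \<alpha> n) [:w * complex_of_real (ln (real n)), 1:])"

lemma dirichlet_convolution_polys_at_0:
  assumes "dirichlet_convolution_polys \<alpha>" and "n \<ge> 2"
  shows "poly (\<alpha> n) 0 = 0"
  using \<open>n \<ge> 2\<close>
proof (induction n rule: less_induct)
  case (less n)
  let ?f = "\<lambda>d. poly (\<alpha> d) 0 * poly (\<alpha> (n div d)) 0"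
  have one: "poly (\<alpha> 1) 0 = 1"
    using assms(1) by (simp add: dirichlet_convolution_polys_def)
  have "\<forall>x y :: real. poly (\<alpha> n) (complex_of_real (x + y)) =
      (\<Sum>d | d dvd n. poly (\<alpha> d) (complex_of_real x) * poly (\<alpha> (n div d)) (complex_of_real y))"
    using assms(1) less.prems unfolding dirichlet_convolution_polys_def by simp
  from this[rule_format, of 0 0] have "poly (\<alpha> n) 0 = (\<Sum>d | d dvd n. ?f d)"
    by simp
  also have "\<dots> = (\<Sum>d\<in>{1, n}. ?f d)"
  proof (rule sum.mono_neutral_right)
    show "finite {d. d dvd n}" using less.prems by simp
    show "{1, n} \<subseteq> {d. d dvd n}" by auto
    show "\<forall>d\<in>{d. d dvd n} - {1, n}. ?f d = 0"
    proof
      fix d assume d: "d \<in> {d. d dvd n} - {1, n}"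
      then have "d < n" "d \<noteq> 0" "d \<noteq> 1" using less.prems by (auto dest: dvd_imp_le)
      then have "poly (\<alpha> d) 0 = 0" using less.IH[of d] by simp
      then show "?f d = 0" by simp
    qed
  qed
  also have "\<dots> = poly (\<alpha> n) 0 + poly (\<alpha> n) 0"
    using less.prems one by simp
  finally show ?case by simp
qed

lemma hat_poly_exact:
  assumes "dirichlet_convolution_polys \<alpha>" and "n \<ge> 2"
  shows "[:0, 1:] * hat_poly \<alpha> n = \<alpha> n"
proof -
  have "[:0, 1:] dvd \<alpha> n"
    using dirichlet_convolution_polys_at_0[OF assms] poly_eq_0_iff_dvd[of "\<alpha> n" 0] by simp
  then show ?thesis
    unfolding hat_poly_def by (rule dvd_mult_div_cancel)
qed

lemma poly_shifted_polys:
  assumes "dirichlet_convolution_polys \<alpha>" and "n \<ge> 1"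
    and nz: "x + w * complex_of_real (ln (real n)) \<noteq> 0"
  shows "poly (shifted_polys \<alpha> w n) x =
    x / (x + w * complex_of_real (ln (real n))) * poly (\<alpha> n) (x + w * complex_of_real (ln (real n)))"
proof (cases "n = 1")
  case True
  then show ?thesis using nz by (simp add: shifted_polys_def)
next
  case False
  let ?z = "x + w * complex_of_real (ln (real n))"
  have "poly (\<alpha> n) ?z = poly ([:0, 1:] * hat_poly \<alpha> n) ?z"
    using hat_poly_exact[OF assms(1)] False assms(2) by simp
  also have "\<dots> = ?z * poly (hat_poly \<alpha> n) ?z" by (simp only: poly_mult) simp
  finally have *: "poly (\<alpha> n) ?z = ?z * poly (hat_poly \<alpha> n) ?z" .
  have "poly (shifted_polys \<alpha> w n) x = x * poly (hat_poly \<alpha> n) ?z"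
    using False by (simp add: shifted_polys_def poly_pcompose add.commute)
  then show ?thesis using nz by (simp add: *)
qed

end

theory Submission
  imports Defs
begin

text \<open>
  Write \<open>L\<close> for the logarithm and \<open>D\<close> for the derivation \<open>f n \<mapsto> L n * f n\<close> of Dirichlet convolution.
  The coefficients of \<open>A = D \<alpha>(x) * \<alpha>(-x)\<close> are additive polynomials in \<open>x\<close>, hence linear, and
  \<open>R j = D\<^sup>j \<alpha>(x) * \<alpha>(-x)\<close> satisfies \<open>R (j+1) = D (R j) + R j * A\<close>, so \<open>R j\<close> has degree at most \<open>j\<close>
  in \<open>x\<close>. Expanding in powers of \<open>w\<close>, these degree bounds give, for \<open>m > 1\<close>,
  \<open>(\<Sum>d | d dvd m. \<beta> d x * \<alpha> (m div d) (- x - w * L d)) = 0\<close>. Consequently, with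
  \<open>B n y = \<alpha> n (y + w * L n)\<close>, one has \<open>\<beta>(x) * B(y) = B(x + y)\<close>. Hence
  \<open>\<beta>(x) * \<beta>(y) * B(0) = \<beta>(x + y) * B(0)\<close>, and \<open>B(0)\<close> can be cancelled because \<open>B 1 0 = 1\<close>.
\<close>

subsection \<open>Dirichlet convolution\<close>

text \<open>At index \<open>0\<close> the divisors form an infinite set, so \<open>dconv f g 0 = 0\<close>.\<close>

definition dconv :: "(nat \<Rightarrow> 'a::comm_semiring_1) \<Rightarrow> (nat \<Rightarrow> 'a) \<Rightarrow> nat \<Rightarrow> 'a" where
  "dconv f g n = (\<Sum>d | d dvd n. f d * g (n div d))"

definition dunit :: "nat \<Rightarrow> 'a::comm_semiring_1" where
  "dunit n = (if n = 1 then 1 else 0)"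

lemma dconv_0 [simp]: "dconv f g 0 = 0"
  by (simp add: dconv_def)

text \<open>A positive \<open>n\<close> has only positive divisors and cofactors, so an identity
  proved for positive indices may be rewritten inside a convolution.\<close>

lemma dconv_cong:
  assumes "\<And>n. n > 0 \<Longrightarrow> f n = f' n" and "\<And>n. n > 0 \<Longrightarrow> g n = g' n"
  shows "dconv f g = dconv f' g'"
proof
  fix n :: nat
  show "dconv f g n = dconv f' g' n"
  proof (cases "n = 0")
    case False
    then show ?thesis
      unfolding dconv_def
      by (intro sum.cong refl arg_cong2[where f = times] assms)
         (auto simp: dvd_div_eq_0_iff intro!: Nat.gr0I)
  qed simp
qed

lemma dconv_commute: "dconv f g = dconv g f"
proof
  fix n :: nat
  show "dconv f g n = dconv g f n"
  proof (cases "n = 0")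
    case False
    then show ?thesis
      unfolding dconv_def
      by (intro sum.reindex_bij_witness[of _ "\<lambda>d. n div d" "\<lambda>d. n div d"])
         (auto simp: mult.commute)
  qed simp
qed

text \<open>Both sides run over the factorizations \<open>n = d * e * c\<close>, with
  \<open>k = d * e\<close>. The summand is a general \<open>F\<close> because a later one couples
  \<open>d\<close> and \<open>e\<close> through a shift by the logarithm of \<open>d\<close>, where
  \<open>dconv_assoc\<close> does not apply.\<close>

lemma sum_divisors_assoc:
  fixes F :: "nat \<Rightarrow> nat \<Rightarrow> nat \<Rightarrow> 'a::comm_monoid_add"
  assumes "n > 0"
  shows "(\<Sum>d | d dvd n. \<Sum>e | e dvd n div d. F d e (n div d div e)) =
         (\<Sum>k | k dvd n. \<Sum>d | d dvd k. F d (k div d) (n div k))"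
proof -
  have fin: "finite {d. d dvd n}" "\<And>d. d dvd n \<Longrightarrow> finite {e. e dvd n div d}"
    "\<And>k. k dvd n \<Longrightarrow> finite {d. d dvd k}"
    using assms by (auto intro!: finite_divisors_nat dest: dvd_pos_nat simp: dvd_div_eq_0_iff intro: Nat.gr0I)
  have "(\<Sum>d | d dvd n. \<Sum>e | e dvd n div d. F d e (n div d div e)) =
      (\<Sum>(d, e)\<in>(SIGMA d:{d. d dvd n}. {e. e dvd n div d}). F d e (n div d div e))"
    by (rule sum.Sigma) (use fin in auto)
  also have "\<dots> = (\<Sum>(k, d)\<in>(SIGMA k:{k. k dvd n}. {d. d dvd k}). F d (k div d) (n div k))"
  proof (rule sum.reindex_bij_witness[of _ "\<lambda>(k, d). (d, k div d)" "\<lambda>(d, e). (d * e, d)"])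
    fix p assume "p \<in> (SIGMA d:{d. d dvd n}. {e. e dvd n div d})"
    then obtain d e where p: "p = (d, e)" and d: "d dvd n" "e dvd n div d" by auto
    then obtain c where n: "n = d * (e * c)" by (metis dvd_def dvd_mult_div_cancel)
    then have "d > 0" "e > 0" using assms by auto
    then show "(case (case p of (d, e) \<Rightarrow> (d * e, d)) of (k, d) \<Rightarrow> (d, k div d)) = p"
      and "(case p of (d, e) \<Rightarrow> (d * e, d)) \<in> (SIGMA k:{k. k dvd n}. {d. d dvd k})"
      and "(case (case p of (d, e) \<Rightarrow> (d * e, d)) of (k, d) \<Rightarrow> F d (k div d) (n div k)) =
        (case p of (d, e) \<Rightarrow> F d e (n div d div e))"
      by (auto simp: p n div_mult2_eq mult.assoc)
  next
    fix p assume "p \<in> (SIGMA k:{k. k dvd n}. {d. d dvd k})"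
    then obtain k d where p: "p = (k, d)" and d: "d dvd k" "k dvd n" by auto
    then obtain e c where n: "n = d * (e * c)" "k = d * e" by (metis dvd_def mult.assoc)
    then have "d > 0" "e > 0" using assms by auto
    then show "(case (case p of (k, d) \<Rightarrow> (d, k div d)) of (d, e) \<Rightarrow> (d * e, d)) = p"
      and "(case p of (k, d) \<Rightarrow> (d, k div d)) \<in> (SIGMA d:{d. d dvd n}. {e. e dvd n div d})"
      by (auto simp: p n)
  qed
  also have "\<dots> = (\<Sum>k | k dvd n. \<Sum>d | d dvd k. F d (k div d) (n div k))"
    by (rule sum.Sigma[symmetric]) (use fin in auto)
  finally show ?thesis .
qed

lemma dconv_assoc: "dconv (dconv f g) h = dconv f (dconv g h)"
proof
  fix n :: nat
  show "dconv (dconv f g) h n = dconv f (dconv g h) n"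
  proof (cases "n = 0")
    case False
    then show ?thesis
      using sum_divisors_assoc[of n "\<lambda>d e c. f d * g e * h c"]
      by (simp add: dconv_def sum_distrib_left sum_distrib_right mult.assoc)
  qed simp
qed

lemma dconv_dunit_left:
  assumes "n > 0"
  shows "dconv dunit f n = f n"
proof -
  have "dconv dunit f n = (\<Sum>d\<in>{1}. dunit d * f (n div d))"
    unfolding dconv_def using assms
    by (intro sum.mono_neutral_right) (auto simp: dunit_def)
  then show ?thesis by (simp add: dunit_def)
qed

lemma dconv_add_left: "dconv (\<lambda>n. f n + g n) h n = dconv f h n + dconv g h n"
  by (simp add: dconv_def distrib_right sum.distrib)

lemma dconv_minus_right:
  fixes f g :: "nat \<Rightarrow> 'a::comm_ring_1"
  shows "dconv f (\<lambda>n. - g n) n = - dconv f g n"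
  by (simp add: dconv_def sum_negf)

text \<open>The divisor \<open>d = n\<close> contributes \<open>f n * h 1 = f n\<close>; every other
  term involves \<open>f\<close> only at smaller indices, so strong induction applies.\<close>

lemma dconv_cancel_right:
  fixes f g h :: "nat \<Rightarrow> 'a::comm_ring_1"
  assumes "h 1 = 1" and eq: "\<And>n. n > 0 \<Longrightarrow> dconv f h n = dconv g h n" and "n > 0"
  shows "f n = g n"
  using \<open>n > 0\<close>
proof (induction n rule: less_induct)
  case (less n)
  have split: "dconv u h n = u n + (\<Sum>d\<in>{d. d dvd n} - {n}. u d * h (n div d))" for u
    unfolding dconv_def using less.prems assms(1)
    by (subst sum.remove[where x = n]) auto
  have "(\<Sum>d\<in>{d. d dvd n} - {n}. f d * h (n div d)) = (\<Sum>d\<in>{d. d dvd n} - {n}. g d * h (n div d))"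
  proof (intro sum.cong refl)
    fix d assume "d \<in> {d. d dvd n} - {n}"
    then have "d < n" "d > 0" using less.prems by (auto dest: dvd_imp_le intro: Nat.gr0I)
    then show "f d * h (n div d) = g d * h (n div d)" using less.IH by simp
  qed
  then show ?case using eq[OF less.prems] by (simp add: split)
qed

lemma dconv_derivation:
  fixes l :: "nat \<Rightarrow> 'a::comm_semiring_1"
  assumes "\<And>m n. m > 0 \<Longrightarrow> n > 0 \<Longrightarrow> l (m * n) = l m + l n"
  shows "l n * dconv f g n = dconv (\<lambda>n. l n * f n) g n + dconv f (\<lambda>n. l n * g n) n"
proof (cases "n = 0")
  case False
  have "l n = l d + l (n div d)" if "d dvd n" for d
    using that False assms[of d "n div d"] by (auto elim!: dvdE)
  then have "l n * dconv f g n = (\<Sum>d | d dvd n. (l d + l (n div d)) * (f d * g (n div d)))"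
    by (simp add: dconv_def sum_distrib_left)
  also have "\<dots> = dconv (\<lambda>n. l n * f n) g n + dconv f (\<lambda>n. l n * g n) n"
    by (simp add: dconv_def algebra_simps sum.distrib)
  finally show ?thesis .
qed simp

lemma poly_dconv: "poly (dconv F G n) x = dconv (\<lambda>n. poly (F n) x) (\<lambda>n. poly (G n) x) n"
  by (simp add: dconv_def poly_sum)

lemma degree_dconv_le:
  fixes F G :: "nat \<Rightarrow> 'a::idom poly"
  assumes "\<And>n. degree (F n) \<le> a" and "\<And>n. degree (G n) \<le> b"
  shows "degree (dconv F G n) \<le> a + b"
proof (cases "n = 0")
  case False
  then show ?thesis
    unfolding dconv_def
    by (intro degree_sum_le finite_divisors_nat order.trans[OF degree_mult_le] add_mono assms) auto
qed simp

subsection \<open>Polynomial identities\<close>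

lemma poly_eq_if_eq_on_reals:
  fixes p q :: "complex poly"
  assumes "\<And>x::real. poly p (of_real x) = poly q (of_real x)"
  shows "p = q"
proof (rule ccontr)
  assume "p \<noteq> q"
  then have "finite {z. poly (p - q) z = 0}" by (intro poly_roots_finite) simp
  moreover have "range complex_of_real \<subseteq> {z. poly (p - q) z = 0}" using assms by auto
  ultimately have "finite (range complex_of_real)" by (rule finite_subset[rotated])
  then show False
    using finite_imageD[of complex_of_real UNIV] infinite_UNIV_char_0[where 'a = real]
    by (simp add: inj_of_real)
qed

text \<open>Additivity gives \<open>p (2 * x) = 2 * p x\<close>. Comparing coefficients,
  \<open>2 ^ i * coeff p i = 2 * coeff p i\<close>, which forces 0 for \<open>i > 1\<close>.\<close>

lemma degree_additive_poly_le_1: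
  fixes p :: "complex poly"
  assumes "\<And>x y. poly p (x + y) = poly p x + poly p y"
  shows "degree p \<le> 1"
proof (rule degree_le, intro allI impI)
  fix i :: nat assume "1 < i"
  have "pcompose p [:0, 2:] = smult 2 p"
    by (rule poly_eq_poly_eq_iff[THEN iffD1], rule ext)
       (simp only: poly_pcompose poly_smult poly_pCons poly_0 mult_zero_right add_0_right add_0_left
          mult_2_right mult_2 assms)
  then have "coeff p i * 2 ^ i = 2 * coeff p i"
    by (metis coeff_pcompose_linear coeff_smult mult.commute)
  moreover have "(2::complex) ^ i \<noteq> 2"
  proof
    assume "(2::complex) ^ i = 2"
    then have "(2::nat) ^ i = 2 ^ 1"
      by (metis of_nat_eq_iff of_nat_numeral of_nat_power power_one_right)
    with \<open>1 < i\<close> show False by (simp only: power_inject_exp)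
  qed
  ultimately show "coeff p i = 0" by (simp add: mult.commute)
qed

text \<open>By the binomial theorem, \<open>w ^ j * x ^ (i - j)\<close> occurs with the j-th
  \<open>t\<close>-moment of the i-th coefficients as a factor, and only for
  \<open>j \<le> i\<close>.\<close>

lemma sum_poly_shift_eq_0:
  fixes q :: "'i \<Rightarrow> 'a::comm_ring_1 poly"
  assumes fin: "finite S"
    and moments: "\<And>i j. j \<le> i \<Longrightarrow> (\<Sum>d\<in>S. t d ^ j * coeff (q d) i) = 0"
  shows "(\<Sum>d\<in>S. poly (q d) (x + w * t d)) = 0"
proof -
  \<comment> \<open>A common degree bound lets the sums over \<open>d\<close> and over powers be
    exchanged; inserting 0 covers empty \<open>S\<close>.\<close>
  define N where "N = Max (insert 0 ((\<lambda>d. degree (q d)) ` S))"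
  have N: "degree (q d) \<le> N" if "d \<in> S" for d
    unfolding N_def using fin that by (intro Max_ge) auto
  have "(\<Sum>d\<in>S. poly (q d) (x + w * t d)) =
      (\<Sum>d\<in>S. \<Sum>i\<le>N. \<Sum>j\<le>i. of_nat (i choose j) * w ^ j * x ^ (i - j) * (t d ^ j * coeff (q d) i))"
  proof (intro sum.cong refl)
    fix d assume "d \<in> S"
    have "poly (q d) (x + w * t d) = (\<Sum>i\<le>N. coeff (q d) i * (w * t d + x) ^ i)"
      unfolding poly_altdef using N[OF \<open>d \<in> S\<close>]
      by (intro sum.mono_neutral_cong_left) (auto simp: coeff_eq_0 add.commute)
    then show "poly (q d) (x + w * t d) =
        (\<Sum>i\<le>N. \<Sum>j\<le>i. of_nat (i choose j) * w ^ j * x ^ (i - j) * (t d ^ j * coeff (q d) i))"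
      by (simp add: binomial_ring sum_distrib_left power_mult_distrib mult_ac)
  qed
  also have "\<dots> = (\<Sum>i\<le>N. \<Sum>j\<le>i. of_nat (i choose j) * w ^ j * x ^ (i - j) *
      (\<Sum>d\<in>S. t d ^ j * coeff (q d) i))"
    by (subst sum.swap, intro sum.cong refl, subst sum.swap) (simp add: sum_distrib_left)
  also have "\<dots> = 0"
    by (intro sum.neutral ballI) (simp add: moments)
  finally show ?thesis .
qed

subsection \<open>Dirichlet convolution polynomials\<close>

text \<open>Constant polynomials, so that weighting by the logarithm stays in the polynomial ring
  and does not raise the degree in \<open>x\<close>.\<close>

definition logp :: "nat \<Rightarrow> complex poly" where
  "logp n = [:complex_of_real (ln (real n)):]"

lemma logp_mult: "m > 0 \<Longrightarrow> n > 0 \<Longrightarrow> logp (m * n) = logp m + logp n"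
  by (simp add: logp_def ln_mult)

context
  fixes \<alpha> :: "nat \<Rightarrow> complex poly"
  assumes dcp: "dirichlet_convolution_polys \<alpha>"
begin

text \<open>The shifts by \<open>w\<close> times a logarithm are complex. With one argument fixed,
  both sides are polynomials in the other, so the real identity extends first in \<open>x\<close>,
  then in \<open>y\<close>.\<close>

lemma poly_add_complex:
  assumes "n > 0"
  shows "poly (\<alpha> n) (x + y) = dconv (\<lambda>n. poly (\<alpha> n) x) (\<lambda>n. poly (\<alpha> n) y) n"
proof -
  have real: "poly (\<alpha> n) (of_real x + of_real y) =
      (\<Sum>d | d dvd n. poly (\<alpha> d) (of_real x) * poly (\<alpha> (n div d)) (of_real y))" for x y :: real
    using dcp assms by (simp add: dirichlet_convolution_polys_def)
  have half: "poly (\<alpha> n) (x + of_real y) =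
      (\<Sum>d | d dvd n. poly (\<alpha> d) x * poly (\<alpha> (n div d)) (of_real y))" for x :: complex and y :: real
  proof -
    have "pcompose (\<alpha> n) [:of_real y, 1:] =
        (\<Sum>d | d dvd n. smult (poly (\<alpha> (n div d)) (of_real y)) (\<alpha> d))"
      by (rule poly_eq_if_eq_on_reals)
         (use real[of _ y] in \<open>simp add: poly_pcompose poly_sum mult.commute add.commute\<close>)
    from arg_cong[OF this, of "\<lambda>p. poly p x"] show ?thesis
      by (simp add: poly_pcompose poly_sum mult.commute add.commute)
  qed
  have "pcompose (\<alpha> n) [:x, 1:] = (\<Sum>d | d dvd n. smult (poly (\<alpha> d) x) (\<alpha> (n div d)))"
    by (rule poly_eq_if_eq_on_reals) (use half[of x] in \<open>simp add: poly_pcompose poly_sum\<close>)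
  from arg_cong[OF this, of "\<lambda>p. poly p y"] show ?thesis
    by (simp add: poly_pcompose poly_sum dconv_def)
qed

lemma poly_at_0:
  assumes "n > 0"
  shows "poly (\<alpha> n) 0 = dunit n"
  using dcp assms dirichlet_convolution_polys_at_0[OF dcp, of n]
  by (auto simp: dunit_def dirichlet_convolution_polys_def)

definition reflected :: "nat \<Rightarrow> complex poly" where
  "reflected n = pcompose (\<alpha> n) [:0, -1:]"

lemma poly_reflected [simp]: "poly (reflected n) x = poly (\<alpha> n) (- x)"
  by (simp add: reflected_def poly_pcompose)

text \<open>Taking \<open>y = - x\<close> in the addition formula leaves the value at 0:
  \<open>reflected\<close> is the Dirichlet inverse of \<open>\<alpha>\<close>.\<close>

lemma dconv_reflected:
  assumes "n > 0"
  shows "dconv \<alpha> reflected n = dunit n"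
proof -
  have "poly (dconv \<alpha> reflected n) x = poly (dunit n) x" for x
    using poly_add_complex[OF assms, of x "- x"] assms
    by (simp add: poly_dconv poly_at_0 dunit_def split: if_splits)
  then show ?thesis by (simp add: poly_eq_poly_eq_iff[symmetric] fun_eq_iff)
qed

section \<open>Logarithmic derivative and degrees of logarithmic moments\<close>

definition log_deriv :: "nat \<Rightarrow> complex poly" where
  "log_deriv = dconv (\<lambda>n. logp n * \<alpha> n) reflected"

text \<open>The logarithmic derivative of a product is the sum of those of its factors: apply the
  Leibniz rule to \<open>a (x + y) = a x * a y\<close> and multiply by the inverse.\<close>

lemma log_deriv_additive: "poly (log_deriv n) (x + y) = poly (log_deriv n) x + poly (log_deriv n) y"
proof (cases "n = 0")
  case False
  define l where "l = (\<lambda>n. complex_of_real (ln (real n)))"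
  define a where "a = (\<lambda>x n. poly (\<alpha> n) x)"
  have l: "l (m * n) = l m + l n" if "m > 0" "n > 0" for m n
    using that by (simp add: l_def ln_mult)
  have a: "a (x + y) n = dconv (a x) (a y) n" if "n > 0" for n x y
    using that by (simp add: a_def poly_add_complex)
  have inv: "dconv (a x) (a (- x)) n = dunit n" if "n > 0" for n x
    using a[OF that, of x "- x"] that by (simp add: a_def poly_at_0)
  have ev: "poly (log_deriv n) x = dconv (\<lambda>n. l n * a x n) (a (- x)) n" for x
    by (simp add: log_deriv_def poly_dconv a_def l_def logp_def)
  have cancel: "dconv (dconv u (a z)) (dconv (a (- z)) v) = dconv u v" for u v z
  proof -
    have "dconv (dconv u (a z)) (dconv (a (- z)) v) = dconv u (dconv (dconv (a z) (a (- z))) v)"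
      by (simp add: dconv_assoc)
    also have "\<dots> = dconv u (dconv dunit v)"
      by (intro dconv_cong refl fun_cong[OF dconv_cong] inv)
    also have "\<dots> = dconv u v"
      by (intro dconv_cong refl) (simp add: dconv_dunit_left)
    finally show ?thesis .
  qed
  have "poly (log_deriv n) (x + y) =
      dconv (\<lambda>n. dconv (\<lambda>n. l n * a x n) (a y) n + dconv (a x) (\<lambda>n. l n * a y n) n) (a (- x - y)) n"
    unfolding ev
    by (intro fun_cong[OF dconv_cong]) (simp_all add: a dconv_derivation[of l] l)
  also have "\<dots> = dconv (dconv (\<lambda>n. l n * a x n) (a y)) (a (- x - y)) n +
      dconv (dconv (a x) (\<lambda>n. l n * a y n)) (a (- x - y)) n"
    by (rule dconv_add_left)
  \<comment> \<open>The inverse is factored so that \<open>a (- y)\<close> stands next to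
    \<open>a y\<close> and \<open>cancel\<close> applies; the other summand is commuted for the same
    purpose.\<close>
  also have "dconv (dconv (\<lambda>n. l n * a x n) (a y)) (a (- x - y)) n =
      dconv (dconv (\<lambda>n. l n * a x n) (a y)) (dconv (a (- y)) (a (- x))) n"
    by (intro fun_cong[OF dconv_cong] refl) (simp add: algebra_simps flip: a)
  also have "\<dots> = poly (log_deriv n) x"
    by (simp add: cancel ev)
  also have "dconv (dconv (a x) (\<lambda>n. l n * a y n)) (a (- x - y)) n =
      dconv (dconv (\<lambda>n. l n * a y n) (a x)) (dconv (a (- x)) (a (- y))) n"
    unfolding dconv_commute[of "a x" "\<lambda>n. l n * a y n"]
    by (intro fun_cong[OF dconv_cong] refl) (simp flip: a)
  also have "\<dots> = poly (log_deriv n) y"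
    by (simp add: cancel ev)
  finally show ?thesis .
qed (simp add: log_deriv_def)

text \<open>This is the rule for differentiating an inverse. The weighted unit vanishes because
  \<open>ln 1 = 0\<close>, so the Leibniz rule on \<open>\<alpha> * reflected\<close> gives 0;
  convolving with \<open>reflected\<close> isolates the derivative.\<close>

lemma logp_reflected:
  assumes "n > 0"
  shows "logp n * reflected n = - dconv reflected log_deriv n"
proof -
  let ?dr = "\<lambda>n. logp n * reflected n"
  have 0: "log_deriv n + dconv \<alpha> ?dr n = 0" if "n > 0" for n
  proof -
    have "log_deriv n + dconv \<alpha> ?dr n = logp n * dunit n"
      unfolding log_deriv_def dconv_reflected[OF that, symmetric]
      by (rule dconv_derivation[symmetric]) (rule logp_mult)
    then show ?thesis by (simp add: dunit_def logp_def split: if_splits)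
  qed
  have "?dr n = dconv dunit ?dr n"
    using assms by (simp add: dconv_dunit_left)
  also have "\<dots> = dconv (dconv reflected \<alpha>) ?dr n"
    unfolding dconv_commute[of reflected] by (intro fun_cong[OF dconv_cong]) (simp_all add: dconv_reflected)
  also have "\<dots> = dconv reflected (\<lambda>n. - log_deriv n) n"
    unfolding dconv_assoc
    by (intro fun_cong[OF dconv_cong] refl) (use 0 in \<open>simp add: eq_neg_iff_add_eq_0 add.commute\<close>)
  also have "\<dots> = - dconv reflected log_deriv n"
    by (rule dconv_minus_right)
  finally show ?thesis .
qed

lemma degree_log_moment_le: "degree (dconv (\<lambda>n. logp n ^ j * \<alpha> n) reflected n) \<le> j"
proof (induction j arbitrary: n)
  case 0
  then show ?case
    by (cases "n = 0") (simp_all add: dconv_reflected dunit_def)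
next
  case (Suc j)
  let ?f = "\<lambda>n. logp n ^ j * \<alpha> n"
  have "logp n * dconv ?f reflected n = dconv (\<lambda>n. logp n ^ Suc j * \<alpha> n) reflected n + dconv ?f (\<lambda>n. logp n * reflected n) n"
    using dconv_derivation[of logp n ?f reflected] logp_mult by (simp add: mult.assoc)
  also have "dconv ?f (\<lambda>n. logp n * reflected n) n = dconv ?f (\<lambda>n. - dconv reflected log_deriv n) n"
    by (intro fun_cong[OF dconv_cong] refl) (simp add: logp_reflected)
  also have "\<dots> = - dconv (dconv ?f reflected) log_deriv n"
    by (simp add: dconv_minus_right dconv_assoc)
  finally have rec: "dconv (\<lambda>n. logp n ^ Suc j * \<alpha> n) reflected n =
      logp n * dconv ?f reflected n + dconv (dconv ?f reflected) log_deriv n"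
    by (simp add: algebra_simps)
  have "degree (logp n * dconv ?f reflected n) \<le> Suc j"
    using Suc[of n] by (intro order.trans[OF degree_mult_le]) (simp add: logp_def)
  \<comment> \<open>Only this term can raise the degree, and by at most one since
    \<open>log_deriv\<close> is linear in \<open>x\<close>.\<close>
  moreover have "degree (dconv (dconv ?f reflected) log_deriv n) \<le> j + 1"
    by (intro degree_dconv_le Suc degree_additive_poly_le_1 log_deriv_additive)
  ultimately show ?case
    unfolding rec by (intro degree_add_le) simp_all
qed

section \<open>Convolution identities for the shifted family\<close>

text \<open>For \<open>m > 1\<close> each summand is \<open>x\<close> times a polynomial
  \<open>q d\<close> evaluated at \<open>x + w * t d\<close>. The moments of the \<open>q d\<close>
  vanish by the degree bound on logarithmic moments.\<close>

lemma sum_shifted_reflected: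
  assumes "m > 0"
  shows "(\<Sum>d | d dvd m. poly (shifted_polys \<alpha> w d) x *
           poly (\<alpha> (m div d)) (- (x + w * complex_of_real (ln (real d))))) = dunit m"
proof (cases "m = 1")
  case True
  then show ?thesis using dcp by (simp add: shifted_polys_def dunit_def dirichlet_convolution_polys_def)
next
  case False
  then have "m > 1" using assms by simp
  define t where "t = (\<lambda>d::nat. complex_of_real (ln (real d)))"
  define q where "q d = (\<alpha> d * reflected (m div d)) div [:0, 1:]" for d
  have q: "\<alpha> d * reflected (m div d) = [:0, 1:] * q d" if "d dvd m" for d
  proof -
    \<comment> \<open>As \<open>m > 1\<close>, one of the two factors has index different from 1 and
      so vanishes at 0, which makes the division by \<open>[:0, 1:]\<close> exact.\<close>
    have "d > 0" "m div d > 0" "d \<noteq> 1 \<or> m div d \<noteq> 1"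
      using that \<open>m > 1\<close> by (auto simp: dvd_div_eq_0_iff intro!: Nat.gr0I)
    then have "poly (\<alpha> d * reflected (m div d)) 0 = 0"
      by (auto simp: poly_at_0 dunit_def)
    then show ?thesis
      unfolding q_def using poly_eq_0_iff_dvd[of "\<alpha> d * reflected (m div d)" 0]
      by (subst dvd_mult_div_cancel) simp_all
  qed
  have "poly (shifted_polys \<alpha> w d) x * poly (\<alpha> (m div d)) (- (x + w * t d)) =
      x * poly (q d) (x + w * t d)" if "d dvd m" for d
  \<comment> \<open>For \<open>d = 1\<close> the factor \<open>x\<close> comes from
    \<open>reflected m\<close>, and the shift is 0; otherwise it comes from
    \<open>\<alpha> d\<close>.\<close>
  proof (cases "d = 1")
    case True
    then show ?thesis
      using arg_cong[OF q[OF that], of "\<lambda>p. poly p x"]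
      by (simp add: shifted_polys_def t_def)
  next
    case False
    then have "d \<ge> 2" using that \<open>m > 1\<close> by (cases "d = 0") auto
    then have "[:0, 1:] * (hat_poly \<alpha> d * reflected (m div d)) = [:0, 1:] * q d"
      using q[OF that] hat_poly_exact[OF dcp, of d] by (metis mult.assoc)
    then have "hat_poly \<alpha> d * reflected (m div d) = q d" by (subst (asm) mult_cancel_left) simp
    from arg_cong[OF this, of "\<lambda>p. poly p (x + w * t d)"] False show ?thesis
      by (simp add: shifted_polys_def poly_pcompose t_def add.commute)
  qed
  then have "(\<Sum>d | d dvd m. poly (shifted_polys \<alpha> w d) x * poly (\<alpha> (m div d)) (- (x + w * t d))) =
      x * (\<Sum>d | d dvd m. poly (q d) (x + w * t d))"
    by (simp add: sum_distrib_left)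
  also have "(\<Sum>d | d dvd m. poly (q d) (x + w * t d)) = 0"
  proof (rule sum_poly_shift_eq_0)
    show "finite {d. d dvd m}" using assms by simp
    fix i j :: nat assume "j \<le> i"
    have "(\<Sum>d | d dvd m. t d ^ j * coeff (q d) i) =
        (\<Sum>d | d dvd m. coeff (logp d ^ j * \<alpha> d * reflected (m div d)) (Suc i))"
    proof (intro sum.cong refl)
      fix d assume "d \<in> {d. d dvd m}"
      then show "t d ^ j * coeff (q d) i = coeff (logp d ^ j * \<alpha> d * reflected (m div d)) (Suc i)"
        using q[of d] by (simp add: mult.assoc logp_def t_def poly_const_pow)
    qed
    also have "\<dots> = coeff (dconv (\<lambda>n. logp n ^ j * \<alpha> n) reflected m) (Suc i)"
      by (simp add: dconv_def coeff_sum)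
    \<comment> \<open>Division by the variable moved coefficient \<open>i\<close> to
      \<open>Suc i\<close>, which exceeds the degree bound \<open>j\<close> exactly when
      \<open>j \<le> i\<close>.\<close>
    also have "\<dots> = 0"
      using degree_log_moment_le[of j m] \<open>j \<le> i\<close> by (intro coeff_eq_0) simp
    finally show "(\<Sum>d | d dvd m. t d ^ j * coeff (q d) i) = 0" .
  qed
  finally show ?thesis using False by (simp add: t_def dunit_def)
qed

text \<open>With \<open>c\<close> fixed by \<open>n\<close>, additivity of the logarithm turns the
  argument at \<open>n div d\<close> into \<open>c - (x + w * t d)\<close>. After expanding and
  regrouping by \<open>k = d * e\<close>, the inner sums collapse to \<open>dunit k\<close>.\<close>

lemma dconv_shifted_translate:
  assumes "n > 0"
  shows "dconv (\<lambda>d. poly (shifted_polys \<alpha> w d) x)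
           (\<lambda>d. poly (\<alpha> d) (y + w * complex_of_real (ln (real d)))) n =
         poly (\<alpha> n) (x + y + w * complex_of_real (ln (real n)))"
proof -
  define t where "t = (\<lambda>d::nat. complex_of_real (ln (real d)))"
  define b where "b = (\<lambda>d. poly (shifted_polys \<alpha> w d) x)"
  define c where "c = x + y + w * t n"
  have "dconv b (\<lambda>d. poly (\<alpha> d) (y + w * t d)) n =
      (\<Sum>d | d dvd n. \<Sum>e | e dvd n div d.
        b d * poly (\<alpha> e) (- (x + w * t d)) * poly (\<alpha> (n div d div e)) c)"
    unfolding dconv_def
  proof (intro sum.cong refl)
    fix d assume "d \<in> {d. d dvd n}"
    then obtain k where n: "n = d * k" by auto
    then have pos: "d > 0" "k > 0" using assms by auto
    then have "y + w * t (n div d) = - (x + w * t d) + c"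
      by (simp add: c_def n t_def ln_mult algebra_simps)
    then show "b d * poly (\<alpha> (n div d)) (y + w * t (n div d)) =
        (\<Sum>e | e dvd n div d. b d * poly (\<alpha> e) (- (x + w * t d)) * poly (\<alpha> (n div d div e)) c)"
      using pos poly_add_complex[of "n div d" "- (x + w * t d)" c]
      by (simp add: n dconv_def sum_distrib_left mult.assoc)
  qed
  also have "\<dots> = (\<Sum>k | k dvd n. \<Sum>d | d dvd k.
      b d * poly (\<alpha> (k div d)) (- (x + w * t d)) * poly (\<alpha> (n div k)) c)"
    by (rule sum_divisors_assoc[OF assms])
  also have "\<dots> = dconv dunit (\<lambda>n. poly (\<alpha> n) c) n"
    unfolding dconv_def
  proof (intro sum.cong refl)
    fix k assume "k \<in> {k. k dvd n}"
    then have "k > 0" using assms by (auto intro: Nat.gr0I)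
    from sum_shifted_reflected[OF this, of w x]
    show "(\<Sum>d | d dvd k. b d * poly (\<alpha> (k div d)) (- (x + w * t d)) * poly (\<alpha> (n div k)) c) =
        dunit k * poly (\<alpha> (n div k)) c"
      by (simp add: b_def t_def flip: sum_distrib_right)
  qed
  also have "\<dots> = poly (\<alpha> n) c"
    by (rule dconv_dunit_left[OF assms])
  finally show ?thesis by (simp add: b_def c_def t_def)
qed

lemma poly_shifted_add:
  assumes "n > 0"
  shows "poly (shifted_polys \<alpha> w n) (x + y) =
    dconv (\<lambda>d. poly (shifted_polys \<alpha> w d) x) (\<lambda>d. poly (shifted_polys \<alpha> w d) y) n"
proof -
  define b where "b = (\<lambda>x d. poly (shifted_polys \<alpha> w d) x)"
  define B where "B = (\<lambda>y d. poly (\<alpha> d) (y + w * complex_of_real (ln (real d))))"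
  have bB: "dconv (b x) (B y) n = B (x + y) n" if "n > 0" for n x y
    using dconv_shifted_translate[OF that] by (simp add: b_def B_def)
  have "b (x + y) n = dconv (b x) (b y) n"
  proof (rule dconv_cancel_right[OF _ _ assms])
    show "B 0 1 = 1" using dcp by (simp add: B_def dirichlet_convolution_polys_def)
    fix n :: nat assume "n > 0"
    \<comment> \<open>The inner product \<open>b y * B 0\<close> becomes \<open>B y\<close>; a
      second use of \<open>bB\<close> then gives \<open>B (x + y)\<close>, as for
      \<open>b (x + y) * B 0\<close>.\<close>
    have "dconv (dconv (b x) (b y)) (B 0) n = dconv (b x) (B y) n"
      unfolding dconv_assoc by (intro fun_cong[OF dconv_cong] refl) (simp add: bB)
    then show "dconv (b (x + y)) (B 0) n = dconv (dconv (b x) (b y)) (B 0) n"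
      using \<open>n > 0\<close> by (simp add: bB)
  qed
  then show ?thesis by (simp add: b_def)
qed

end

theorem theorem1:
  fixes \<alpha> :: "nat \<Rightarrow> complex poly" and w :: complex
  assumes "dirichlet_convolution_polys \<alpha>"
  shows "dirichlet_convolution_polys (shifted_polys \<alpha> w)"
  using assms poly_shifted_add[OF assms]
  by (simp add: dirichlet_convolution_polys_def dconv_def shifted_polys_def)

end
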